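(* Let $\lambda\in\mathbb{R}$, let $\alpha>0$, and let $X_\lambda$ be a degenerate zero-truncated Poisson random variable with parameter $\alpha$. Then, for $\lambda\neq-\frac1\alpha$, the variance of $X_\lambda$ is $$\mathrm{Var}[X_\lambda]=\frac{\alpha(1+\alpha)}{(1+\alpha\lambda)^2}\,\frac{e_\lambda(\alpha)}{e_\lambda(\alpha)-1}-\Big(\frac{\alpha}{1+\alpha\lambda}\Big)^2\Big(\frac{e_\lambda(\alpha)}{e_\lambda(\alpha)-1}\Big)^2.$$
   Context: For real $x,\lambda$ the $\lambda$-falling factorials are $(x)_{0,\lambda}=1$ and $(x)_{n,\lambda}=x(x-\lambda)(x-2\lambda)\cdots(x-(n-1)\lambda)$ for $n\ge1$. The degenerate exponential is $e_\lambda^x(t)=(1+\lambda t)^{x/\lambda}=\sum_{n=0}^\infty (x)_{n,\lambda}\frac{t^n}{n!}$ (for $\lambda=0$ it is understood as the limit $e^{xt}$), with $e_\lambda(t)=e_\lambda^1(t)$. A random variable $X_\lambda$ taking values in $\{1,2,3,\dots\}$ is a degenerate zero-truncated Poisson random variable with parameter $\alpha>0$ if its probability mass function is $$P_\lambda(n)=P\{X_\lambda=n\}=\frac{1}{e_\lambda(\alpha)-1}\,\frac{\alpha^n}{n!}\,(1)_{n,\lambda},\qquad n=1,2,3,\dots$$ As part of this definition, $\lambda$ and $\alpha$ are such that this formula is meaningful and is a probability mass function (the values are nonnegative, and the series $\sum_{n\ge 0}(1)_{n,\lambda}\alpha^n/n!$ converges to $e_\lambda(\alpha)$, so that the values sum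 to $1$). The variance is $\mathrm{Var}[X_\lambda]=E[(X_\lambda-E[X_\lambda])^2]$. *)

theory Defs
  imports "HOL-Probability.Probability"
begin

definition deg_falling :: "real \<Rightarrow> nat \<Rightarrow> real \<Rightarrow> real" where
  "deg_falling x n l = (\<Prod>k<n. x - real k * l)"

text \<open>For \<open>l = 0\<close> the degenerate exponential is the limit of \<open>(1 + l * t) powr (x / l)\<close> as
  \<open>l\<close> tends to 0. For \<open>1 + l * t \<le> 0\<close> the value of \<open>powr\<close> is not meaningful; such values are
  excluded below by the convergence of the series.\<close>

definition deg_exp :: "real \<Rightarrow> real \<Rightarrow> real \<Rightarrow> real" where
  "deg_exp l x t = (if l = 0 then exp (x * t) else (1 + l * t) powr (x / l))"

definition deg_ztp_mass :: "real \<Rightarrow> real \<Rightarrow> nat \<Rightarrow> real" where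
  "deg_ztp_mass l \<alpha> n =
     1 / (deg_exp l 1 \<alpha> - 1) * (\<alpha> ^ n / fact n) * deg_falling 1 n l"

text \<open>The parameters for which \<^const>\<open>deg_ztp_mass\<close> is a probability mass function on the
  positive integers. If \<open>l < 0\<close> and \<open>1 + l * \<alpha> \<le> 0\<close>, the series diverges; if \<open>l > 0\<close>,
  nonnegativity forces \<open>1 / l\<close> to be an integer.\<close>

definition deg_ztp_admissible :: "real \<Rightarrow> real \<Rightarrow> bool" where
  "deg_ztp_admissible l \<alpha> \<longleftrightarrow>
     (\<forall>n\<ge>1. 0 \<le> deg_ztp_mass l \<alpha> n) \<and>
     (\<lambda>n. deg_falling 1 n l * \<alpha> ^ n / fact n) sums deg_exp l 1 \<alpha>"

definition deg_zero_truncated_poisson ::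
    "'a measure \<Rightarrow> real \<Rightarrow> real \<Rightarrow> ('a \<Rightarrow> nat) \<Rightarrow> bool" where
  "deg_zero_truncated_poisson M l \<alpha> X \<longleftrightarrow>
     0 < \<alpha> \<and> deg_ztp_admissible l \<alpha> \<and>
     X \<in> M \<rightarrow>\<^sub>M count_space UNIV \<and>
     (\<forall>\<omega>\<in>space M. 1 \<le> X \<omega>) \<and>
     (\<forall>n\<ge>1. measure M {\<omega> \<in> space M. X \<omega> = n} = deg_ztp_mass l \<alpha> n)"

end

theory Submission imports Defs begin

text \<open>
  Put \<open>a n = (1)\<^sub>n\<^sub>,\<^sub>l \<alpha>\<^sup>n / n!\<close>, so that the mass at \<open>n \<ge> 1\<close> is \<open>a n / (e - 1)\<close> with
  \<open>e = (\<Sum>n. a n)\<close> the degenerate exponential.  These weights satisfy the first order recurrence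
  \<open>(n + 1) * a (n + 1) = (b + c * n) * a n\<close> with \<open>b = \<alpha>\<close> and \<open>c = - \<alpha> * l\<close>.  Summing the
  recurrence, and summing it once more after multiplication by \<open>n + 1\<close>, expresses the sums
  \<open>S\<^sub>1 = (\<Sum>n. n * a n)\<close> and \<open>S\<^sub>2 = (\<Sum>n. n\<^sup>2 * a n)\<close> linearly in terms of themselves:
  \<open>S\<^sub>1 = b * e + c * S\<^sub>1\<close> and \<open>S\<^sub>2 = b * e + (b + c) * S\<^sub>1 + c * S\<^sub>2\<close>.  If \<open>c < 1\<close>, these equations
  can be solved, and the same equations for partial sums bound the
  partial sums, so no differentiation of the power series and no separate convergence test is
  needed (\<open>linear_recurrence_moments\<close>).

  The condition \<open>c < 1\<close>, that is \<open>1 + \<alpha> * l > 0\<close>, is where the assumption \<open>l \<noteq> - 1 / \<alpha>\<close> enters: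
  for \<open>c > 1\<close> the weights are positive and eventually increasing, so their series diverges
  (\<open>summable_deg_weight_imp\<close>), and \<open>c = 1\<close> is excluded by hypothesis.  It also gives \<open>e > 1\<close>,
  so that nonnegativity of the masses is nonnegativity of the weights.  The variance is finally
  \<open>S\<^sub>2 / (e - 1) - (S\<^sub>1 / (e - 1))\<^sup>2\<close>.
\<close>

section \<open>Moments of weights with a linear recurrence\<close>

text \<open>Nonnegative terms make partial sums increasing.  If \<open>T N\<close> is the partial sum of the first
  \<open>N\<close> terms, an identity \<open>T (N + 1) = U N + c * T N\<close> with \<open>U N \<le> B\<close> therefore gives
  \<open>(1 - c) * T N \<le> B\<close>, which bounds the partial sums.\<close>

lemma summable_of_contracting_partial_sums:
  fixes f :: "nat \<Rightarrow> real"
  assumes nonneg: "\<And>n. 0 \<le> f n" and "c < 1"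
    and step: "\<And>N. sum f {..<Suc N} \<le> B + c * sum f {..<N}"
  shows "summable f"
proof (rule bounded_imp_summable)
  fix N
  have "sum f {..N} \<le> sum f {..<Suc (Suc N)}"
    using nonneg[of "Suc N"] by (simp add: lessThan_Suc_atMost)
  also have "\<dots> \<le> B + c * sum f {..N}"
    using step[of "Suc N"] by (simp only: lessThan_Suc_atMost)
  finally have "(1 - c) * sum f {..N} \<le> B"
    by (simp add: algebra_simps)
  with \<open>c < 1\<close> show "sum f {..N} \<le> B / (1 - c)"
    by (simp add: field_simps)
qed (rule nonneg)

text \<open>The weights with this recurrence are the Panjer class (binomial, Poisson and negative
  binomial up to normalisation), according to the sign of \<open>c\<close>.  The first moment is obtained by
  shifting the index in \<open>(\<Sum>n. n * a n)\<close>, the second one by shifting it in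
  \<open>(\<Sum>n. n\<^sup>2 * a n)\<close>.\<close>

lemma linear_recurrence_moments:
  fixes a :: "nat \<Rightarrow> real"
  assumes nonneg: "\<And>n. 0 \<le> a n"
    and rec: "\<And>n. real (Suc n) * a (Suc n) = (b + c * real n) * a n"
    and "c < 1" and a: "a sums s"
  shows "(\<lambda>n. real n * a n) sums (b * s / (1 - c))"
    and "(\<lambda>n. (real n)\<^sup>2 * a n) sums ((b * s + (b + c) * (b * s / (1 - c))) / (1 - c))"
proof -
  define f where "f n = real n * a n" for n
  define g where "g n = (real n)\<^sup>2 * a n" for n
  have f_Suc: "f (Suc n) = b * a n + c * f n" for n
    using rec[of n] by (simp add: f_def algebra_simps)
  have g_Suc: "g (Suc n) = b * a n + (b + c) * f n + c * g n" for n
  proof -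
    have "g (Suc n) = real (Suc n) * f (Suc n)"
      by (simp only: f_def g_def power2_eq_square mult.assoc)
    then show ?thesis
      by (simp add: f_Suc) (simp add: f_def g_def algebra_simps power2_eq_square)
  qed
  have f0: "f 0 = 0" and g0: "g 0 = 0"
    by (simp_all add: f_def g_def)
  have f_nonneg: "0 \<le> f n" and g_nonneg: "0 \<le> g n" for n
    by (simp_all add: f_def g_def nonneg)
  have a_le: "sum a {..<N} \<le> s" for N
    using sum_le_suminf[OF sums_summable[OF a], of "{..<N}"] nonneg sums_unique[OF a] by simp
  have a_nonneg: "0 \<le> sum a {..<N}" for N
    by (simp add: sum_nonneg nonneg)

  have sf: "summable f"
  proof (rule summable_of_contracting_partial_sums[OF f_nonneg \<open>c < 1\<close>])
    fix N
    have "sum f {..<Suc N} = b * sum a {..<N} + c * sum f {..<N}"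
      by (subst sum.lessThan_Suc_shift) (simp add: f0 f_Suc sum.distrib sum_distrib_left)
    also have "b * sum a {..<N} \<le> \<bar>b\<bar> * s"
      using a_le[of N] a_nonneg[of N] by (intro mult_mono) auto
    finally show "sum f {..<Suc N} \<le> \<bar>b\<bar> * s + c * sum f {..<N}"
      by simp
  qed
  define s1 where "s1 = suminf f"
  have fs: "f sums s1"
    using sf by (simp add: s1_def summable_sums)
  have "(\<lambda>n. f (Suc n)) sums s1"
    using fs by (simp add: sums_Suc_iff f0)
  moreover have "(\<lambda>n. f (Suc n)) sums (b * s + c * s1)"
    unfolding f_Suc by (intro sums_add sums_mult a fs)
  ultimately have "s1 = b * s + c * s1"
    by (rule sums_unique2)
  then have s1: "s1 = b * s / (1 - c)"
    using \<open>c < 1\<close> by (simp add: field_simps)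
  show "(\<lambda>n. real n * a n) sums (b * s / (1 - c))"
    using fs unfolding f_def s1 .

  have f_le: "sum f {..<N} \<le> s1" for N
    using sum_le_suminf[OF sf, of "{..<N}"] f_nonneg by (simp add: s1_def)
  have fs_nonneg: "0 \<le> sum f {..<N}" for N
    by (simp add: sum_nonneg f_nonneg)
  have sg: "summable g"
  proof (rule summable_of_contracting_partial_sums[OF g_nonneg \<open>c < 1\<close>])
    fix N
    have "sum g {..<Suc N} = b * sum a {..<N} + (b + c) * sum f {..<N} + c * sum g {..<N}"
      by (subst sum.lessThan_Suc_shift) (simp add: g0 g_Suc sum.distrib sum_distrib_left)
    moreover have "b * sum a {..<N} \<le> \<bar>b\<bar> * s"
      using a_le[of N] a_nonneg[of N] by (intro mult_mono) auto
    moreover have "(b + c) * sum f {..<N} \<le> \<bar>b + c\<bar> * s1"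
      using f_le[of N] fs_nonneg[of N] by (intro mult_mono) auto
    ultimately show "sum g {..<Suc N} \<le> (\<bar>b\<bar> * s + \<bar>b + c\<bar> * s1) + c * sum g {..<N}"
      by linarith
  qed
  define s2 where "s2 = suminf g"
  have gs: "g sums s2"
    using sg by (simp add: s2_def summable_sums)
  have "(\<lambda>n. g (Suc n)) sums s2"
    using gs by (simp add: sums_Suc_iff g0)
  moreover have "(\<lambda>n. g (Suc n)) sums (b * s + (b + c) * s1 + c * s2)"
    unfolding g_Suc by (intro sums_add sums_mult a fs gs)
  ultimately have "s2 = b * s + (b + c) * s1 + c * s2"
    by (rule sums_unique2)
  then have "s2 * (1 - c) = b * s + (b + c) * s1"
    by (simp add: algebra_simps)
  then have "s2 = (b * s + (b + c) * s1) / (1 - c)"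
    using \<open>c < 1\<close> by (simp add: eq_divide_eq)
  with gs show "(\<lambda>n. (real n)\<^sup>2 * a n) sums ((b * s + (b + c) * (b * s / (1 - c))) / (1 - c))"
    unfolding g_def s1 by simp
qed

section \<open>The degenerate exponential series\<close>

definition deg_weight :: "real \<Rightarrow> real \<Rightarrow> nat \<Rightarrow> real" where
  "deg_weight l \<alpha> n = deg_falling 1 n l * \<alpha> ^ n / fact n"

lemma deg_weight_0 [simp]: "deg_weight l \<alpha> 0 = 1"
  by (simp add: deg_weight_def deg_falling_def)

lemma deg_weight_Suc:
  "real (Suc n) * deg_weight l \<alpha> (Suc n) = (\<alpha> + (- \<alpha> * l) * real n) * deg_weight l \<alpha> n"
  by (simp add: deg_weight_def deg_falling_def field_simps del: of_nat_Suc)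

text \<open>For \<open>1 + \<alpha> * l < 0\<close> the parameter \<open>l\<close> is negative, so that all weights are positive, and
  the quotient of consecutive weights tends to \<open>- \<alpha> * l > 1\<close>.  The terms of the series then
  increase from some index on and cannot tend to 0.\<close>

lemma summable_deg_weight_imp:
  assumes "0 < \<alpha>" and summable: "summable (deg_weight l \<alpha>)"
  shows "0 \<le> 1 + \<alpha> * l"
proof (rule ccontr)
  assume "\<not> 0 \<le> 1 + \<alpha> * l"
  then have c: "1 < - \<alpha> * l" by simp
  have "l < 0"
    using c \<open>0 < \<alpha>\<close> by (smt (verit) mult_nonneg_nonneg mult_minus_left)
  then have "0 < 1 - real k * l" for k
    by (smt (verit) mult_nonneg_nonpos of_nat_0_le_iff)
  then have pos: "0 < deg_weight l \<alpha> n" for n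
    using \<open>0 < \<alpha>\<close> unfolding deg_weight_def deg_falling_def
    by (intro divide_pos_pos mult_pos_pos prod_pos) auto
  obtain m where m: "1 / (- \<alpha> * l - 1) < real m"
    using reals_Archimedean2 by blast
  have mono: "deg_weight l \<alpha> n \<le> deg_weight l \<alpha> (Suc n)" if "m \<le> n" for n
  proof -
    have "1 / (- \<alpha> * l - 1) < real n"
      using m that by linarith
    then have "1 \<le> (- \<alpha> * l - 1) * real n"
      using c by (simp add: field_simps)
    then have "real (Suc n) \<le> \<alpha> + (- \<alpha> * l) * real n"
      using \<open>0 < \<alpha>\<close> by (simp add: algebra_simps)
    then have "real (Suc n) * deg_weight l \<alpha> n \<le> real (Suc n) * deg_weight l \<alpha> (Suc n)"
      unfolding deg_weight_Suc using pos[of n] by (intro mult_right_mono) auto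
    then show ?thesis
      by simp
  qed
  have "deg_weight l \<alpha> m \<le> deg_weight l \<alpha> n" if "m \<le> n" for n
    using that by (induction rule: dec_induct) (use mono order_trans in blast)+
  then have "deg_weight l \<alpha> m \<le> 0"
    by (intro LIMSEQ_le_const[OF summable_LIMSEQ_zero[OF summable]]) auto
  with pos[of m] show False by simp
qed

lemma deg_exp_gt_1:
  assumes "0 < \<alpha>" "0 < 1 + \<alpha> * l"
  shows "1 < deg_exp l 1 \<alpha>"
proof -
  consider "l = 0" | "0 < l" | "l < 0" by linarith
  then show ?thesis
  proof cases
    case 2
    then have "1 < 1 + l * \<alpha>" using assms by simp
    with 2 show ?thesis
      by (simp add: deg_exp_def gr_one_powr)
  next
    case 3
    then have "1 + l * \<alpha> < 1" using assms by (simp add: mult_neg_pos)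
    with 3 assms have "(1 + l * \<alpha>) powr 0 < (1 + l * \<alpha>) powr (1 / l)"
      by (intro powr_less_mono') (auto simp: mult.commute)
    with 3 assms show ?thesis
      by (simp add: deg_exp_def mult.commute)
  qed (use assms in \<open>simp add: deg_exp_def\<close>)
qed

section \<open>Expectations of functions of a counting variable\<close>

lemma (in prob_space) expectation_nat_sums:
  fixes X :: "'a \<Rightarrow> nat" and f :: "nat \<Rightarrow> real"
  assumes X [measurable]: "X \<in> M \<rightarrow>\<^sub>M count_space UNIV"
    and nonneg: "\<And>n. 0 \<le> f n"
    and sums: "(\<lambda>n. prob {\<omega> \<in> space M. X \<omega> = n} * f n) sums s"
  shows "integrable M (\<lambda>\<omega>. f (X \<omega>))" and "expectation (\<lambda>\<omega>. f (X \<omega>)) = s"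
proof -
  define p where "p n = prob {\<omega> \<in> space M. X \<omega> = n}" for n
  have p_nonneg: "0 \<le> p n" for n by (simp add: p_def)
  have D: "distr M (count_space UNIV) X = density (count_space UNIV) (\<lambda>n. ennreal (p n))"
  proof (rule measure_eqI_countable[where A = UNIV])
    fix n
    have "X -` {n} \<inter> space M = {\<omega> \<in> space M. X \<omega> = n}" by auto
    then show "emeasure (distr M (count_space UNIV) X) {n} =
        emeasure (density (count_space UNIV) (\<lambda>n. ennreal (p n))) {n}"
      by (simp add: emeasure_distr emeasure_density p_def emeasure_eq_measure
          nn_integral_count_space_indicator[symmetric])
  qed auto
  have int: "integrable (count_space UNIV) (\<lambda>n. p n * f n)"
    using sums_summable[OF sums] nonneg p_nonneg
    by (simp add: integrable_count_space_nat_iff p_def)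
  then have "integrable (distr M (count_space UNIV) X) f"
    unfolding D by (subst integrable_density) (auto simp: p_nonneg)
  then show "integrable M (\<lambda>\<omega>. f (X \<omega>))"
    by (rule integrable_distr[OF X])
  have "expectation (\<lambda>\<omega>. f (X \<omega>)) = integral\<^sup>L (distr M (count_space UNIV) X) f"
    by (rule integral_distr[symmetric]) auto
  also have "\<dots> = (LINT n|count_space UNIV. p n * f n)"
    unfolding D by (subst integral_density) (auto simp: p_nonneg)
  also have "\<dots> = s"
    using sums_integral_count_space_nat[OF int] sums sums_unique2 unfolding p_def by blast
  finally show "expectation (\<lambda>\<omega>. f (X \<omega>)) = s" .
qed

section \<open>The variance\<close>

theorem theorem2p2:
  fixes M :: "'a measure" and l \<alpha> :: real and X :: "'a \<Rightarrow> nat"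
  assumes "prob_space M"
    and "0 < \<alpha>"
    and "deg_zero_truncated_poisson M l \<alpha> X"
    and "l \<noteq> - 1 / \<alpha>"
  shows "integrable M (\<lambda>\<omega>. real (X \<omega>))
    \<and> integrable M (\<lambda>\<omega>. (real (X \<omega>) - prob_space.expectation M (\<lambda>\<omega>. real (X \<omega>)))\<^sup>2)
    \<and> prob_space.variance M (\<lambda>\<omega>. real (X \<omega>)) =
        \<alpha> * (1 + \<alpha>) / (1 + \<alpha> * l)\<^sup>2 * (deg_exp l 1 \<alpha> / (deg_exp l 1 \<alpha> - 1))
        - (\<alpha> / (1 + \<alpha> * l))\<^sup>2 * (deg_exp l 1 \<alpha> / (deg_exp l 1 \<alpha> - 1))\<^sup>2"
proof -
  interpret prob_space M by fact
  define e where "e = deg_exp l 1 \<alpha>"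
  define d where "d = 1 + \<alpha> * l"
  define a where "a = deg_weight l \<alpha>"
  have X: "X \<in> M \<rightarrow>\<^sub>M count_space UNIV"
    and mass_nonneg: "\<And>n. 1 \<le> n \<Longrightarrow> 0 \<le> deg_ztp_mass l \<alpha> n"
    and prob: "\<And>n. 1 \<le> n \<Longrightarrow> prob {\<omega> \<in> space M. X \<omega> = n} = deg_ztp_mass l \<alpha> n"
    and a_sums: "a sums e"
    using assms(3)
    by (auto simp: deg_zero_truncated_poisson_def deg_ztp_admissible_def a_def e_def
        deg_weight_def[abs_def])
  have mass: "deg_ztp_mass l \<alpha> n = a n / (e - 1)" for n
    by (simp add: deg_ztp_mass_def a_def deg_weight_def e_def mult.commute)
  have "0 \<le> d"
    using summable_deg_weight_imp[OF \<open>0 < \<alpha>\<close>] a_sums by (auto simp: a_def d_def sums_iff)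
  moreover have "d \<noteq> 0"
    using \<open>l \<noteq> - 1 / \<alpha>\<close> \<open>0 < \<alpha>\<close> by (auto simp: d_def field_simps)
  ultimately have "0 < d" by simp
  then have "1 < e"
    using deg_exp_gt_1 \<open>0 < \<alpha>\<close> by (simp add: d_def e_def)
  have a_nonneg: "0 \<le> a n" for n
  proof (cases "n = 0")
    case False
    then show ?thesis
      using mass_nonneg[of n] \<open>1 < e\<close> by (simp add: mass zero_le_divide_iff)
  qed (simp add: a_def)

  have a_Suc: "real (Suc n) * a (Suc n) = (\<alpha> + (- \<alpha> * l) * real n) * a n" for n
    unfolding a_def by (rule deg_weight_Suc)
  have "- \<alpha> * l < 1"
    using \<open>0 < d\<close> by (simp add: d_def)
  note moments = linear_recurrence_moments[OF a_nonneg a_Suc this a_sums]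
  have d: "1 - - \<alpha> * l = d"
    by (simp add: d_def)
  define m1 where "m1 = \<alpha> * e / d / (e - 1)"
  define m2 where "m2 = (\<alpha> * e + (\<alpha> + - \<alpha> * l) * (\<alpha> * e / d)) / d / (e - 1)"
  \<comment> \<open>The mass function at 0 differs from the probability of 0, but both are multiplied by 0.\<close>
  have "(\<lambda>n. prob {\<omega> \<in> space M. X \<omega> = n} * real n) = (\<lambda>n. real n * a n / (e - 1))"
  proof
    show "prob {\<omega> \<in> space M. X \<omega> = n} * real n = real n * a n / (e - 1)" for n
      by (cases "n = 0") (simp_all add: prob mass)
  qed
  then have s1: "(\<lambda>n. prob {\<omega> \<in> space M. X \<omega> = n} * real n) sums m1"
    using sums_divide[OF moments(1), of "e - 1"] by (simp only: d m1_def)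
  have "(\<lambda>n. prob {\<omega> \<in> space M. X \<omega> = n} * (real n)\<^sup>2) = (\<lambda>n. (real n)\<^sup>2 * a n / (e - 1))"
  proof
    show "prob {\<omega> \<in> space M. X \<omega> = n} * (real n)\<^sup>2 = (real n)\<^sup>2 * a n / (e - 1)" for n
      by (cases "n = 0") (simp_all add: prob mass)
  qed
  then have s2: "(\<lambda>n. prob {\<omega> \<in> space M. X \<omega> = n} * (real n)\<^sup>2) sums m2"
    using sums_divide[OF moments(2), of "e - 1"] by (simp only: d m2_def)
  have int1: "integrable M (\<lambda>\<omega>. real (X \<omega>))" and E1: "expectation (\<lambda>\<omega>. real (X \<omega>)) = m1"
    using expectation_nat_sums[OF X _ s1] by simp_all
  have int2: "integrable M (\<lambda>\<omega>. (real (X \<omega>))\<^sup>2)" and E2: "expectation (\<lambda>\<omega>. (real (X \<omega>))\<^sup>2) = m2"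
    using expectation_nat_sums[OF X _ s2] by simp_all
  have int3: "integrable M (\<lambda>\<omega>. (real (X \<omega>) - expectation (\<lambda>\<omega>. real (X \<omega>)))\<^sup>2)"
    unfolding power2_diff using int1 int2 by simp
  have var: "variance (\<lambda>\<omega>. real (X \<omega>)) = m2 - m1\<^sup>2"
    using variance_eq[OF int1 int2] by (simp add: E1 E2)
  have "\<alpha> * e + (\<alpha> + - \<alpha> * l) * (\<alpha> * e / d) = \<alpha> * (1 + \<alpha>) * e / d"
    using \<open>0 < d\<close> by (simp add: field_simps) (simp add: d_def algebra_simps)
  then have "m2 = \<alpha> * (1 + \<alpha>) / d\<^sup>2 * (e / (e - 1))"
    by (simp add: m2_def power2_eq_square)
  moreover have "m1\<^sup>2 = (\<alpha> / d)\<^sup>2 * (e / (e - 1))\<^sup>2"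
    by (simp add: m1_def power_mult_distrib power_divide)
  ultimately show ?thesis
    using int1 int3 var by (simp add: e_def d_def)
qed

end
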